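(* Let $n\ge 4$ and let $(M^n,g_{ij},f)$ be a complete gradient shrinking Ricci soliton, i.e. $R_{ij}+\nabla_i\nabla_j f=\frac12 g_{ij}$, with vanishing $D_{ijk}$. Then the Cotton tensor $C_{ijk}=0$ at all points where $\nabla f\neq 0$.
   Context: A complete gradient shrinking Ricci soliton $(M^n,g_{ij},f)$ is a complete Riemannian manifold $(M^n,g_{ij})$ together with a smooth function $f$ such that the Ricci tensor satisfies $R_{ij}+\nabla_i\nabla_j f=\frac12 g_{ij}$. $R$ is the scalar curvature. The Cotton tensor is $$C_{ijk}=\nabla_iR_{jk}-\nabla_jR_{ik}-\frac{1}{2(n-1)}(g_{jk}\nabla_iR-g_{ik}\nabla_jR).$$ The covariant 3-tensor $D_{ijk}$ is defined by $$D_{ijk}=\frac{1}{n-2}(R_{jk}\nabla_i f-R_{ik}\nabla_j f)+\frac{1}{2(n-1)(n-2)}(g_{jk}\nabla_i R-g_{ik}\nabla_j R)-\frac{R}{(n-1)(n-2)}(g_{jk}\nabla_i f-g_{ik}\nabla_j f).$$ *)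

theory Defs
  imports "HOL-Analysis.Analysis"
begin

section \<open>Smooth functions on open subsets of a normed space\<close>

primrec Ck_on :: "nat \<Rightarrow> 'a::real_normed_vector set \<Rightarrow> ('a \<Rightarrow> 'b::real_normed_vector) \<Rightarrow> bool" where
  "Ck_on 0 S F \<longleftrightarrow> continuous_on S F"
| "Ck_on (Suc k) S F \<longleftrightarrow>
     (\<forall>x\<in>S. F differentiable (at x)) \<and> (\<forall>v. Ck_on k S (\<lambda>x. frechet_derivative F (at x) v))"

definition smooth_on :: "'a::real_normed_vector set \<Rightarrow> ('a \<Rightarrow> 'b::real_normed_vector) \<Rightarrow> bool" where
  "smooth_on S F \<longleftrightarrow> (\<forall>k. Ck_on k S F)"

definition partial :: "'n::finite \<Rightarrow> (real^'n \<Rightarrow> real) \<Rightarrow> real^'n \<Rightarrow> real" where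
  "partial i F x = frechet_derivative F (at x) (axis i 1)"


section \<open>Smooth manifolds\<close>

text \<open>A chart is a domain together with a coordinate map; the values of the coordinate map
  outside the domain are irrelevant.\<close>

type_synonym ('a, 'n) chart = "'a set \<times> ('a \<Rightarrow> real^'n)"

abbreviation chart_dom :: "('a, 'n) chart \<Rightarrow> 'a set" where "chart_dom \<equiv> fst"

abbreviation chart_map :: "('a, 'n) chart \<Rightarrow> 'a \<Rightarrow> real^'n" where "chart_map \<equiv> snd"

definition chart_inv :: "('a, 'n) chart \<Rightarrow> real^'n \<Rightarrow> 'a" where
  "chart_inv c = inv_into (chart_dom c) (chart_map c)"

definition chart_image :: "('a, 'n) chart \<Rightarrow> (real^'n) set" where
  "chart_image c = chart_map c ` chart_dom c"

definition is_chart :: "'a topology \<Rightarrow> ('a, 'n::finite) chart \<Rightarrow> bool" where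
  "is_chart X c \<longleftrightarrow> openin X (chart_dom c) \<and> open (chart_image c) \<and>
     homeomorphic_map (subtopology X (chart_dom c)) (top_of_set (chart_image c)) (chart_map c)"

definition transition :: "('a, 'n) chart \<Rightarrow> ('a, 'n) chart \<Rightarrow> real^'n \<Rightarrow> real^'n" where
  "transition c d = chart_map d \<circ> chart_inv c"

definition smooth_manifold :: "'a topology \<Rightarrow> ('a, 'n::finite) chart set \<Rightarrow> bool" where
  "smooth_manifold X A \<longleftrightarrow>
     Hausdorff_space X \<and> second_countable X \<and>
     (\<forall>c\<in>A. is_chart X c) \<and> topspace X = (\<Union>c\<in>A. chart_dom c) \<and>
     (\<forall>c\<in>A. \<forall>d\<in>A. smooth_on (chart_map c ` (chart_dom c \<inter> chart_dom d)) (transition c d))"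

definition local_rep :: "('a, 'n) chart \<Rightarrow> ('a \<Rightarrow> real) \<Rightarrow> real^'n \<Rightarrow> real" where
  "local_rep c f = f \<circ> chart_inv c"

definition smooth_function :: "('a, 'n::finite) chart set \<Rightarrow> ('a \<Rightarrow> real) \<Rightarrow> bool" where
  "smooth_function A f \<longleftrightarrow> (\<forall>c\<in>A. smooth_on (chart_image c) (local_rep c f))"


section \<open>Riemannian metrics\<close>

text \<open>A metric is given by its component matrices: \<open>g c x $ i $ j\<close> is the component
  \<open>g\<^sub>i\<^sub>j\<close> in the chart \<open>c\<close> at the point with coordinates \<open>x\<close>.  Components in overlapping
  charts are related by the transformation law of a covariant 2-tensor.\<close>

type_synonym 'n metric_comp = "real^'n \<Rightarrow> real^'n^'n"

definition riemannian_metric ::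
    "('a, 'n::finite) chart set \<Rightarrow> (('a, 'n) chart \<Rightarrow> 'n metric_comp) \<Rightarrow> bool" where
  "riemannian_metric A g \<longleftrightarrow>
     (\<forall>c\<in>A. smooth_on (chart_image c) (g c) \<and>
        (\<forall>x\<in>chart_image c. transpose (g c x) = g c x \<and> (\<forall>v. v \<noteq> 0 \<longrightarrow> v \<bullet> (g c x *v v) > 0))) \<and>
     (\<forall>c\<in>A. \<forall>d\<in>A. \<forall>p\<in>chart_dom c \<inter> chart_dom d. \<forall>i j.
        g c (chart_map c p) $ i $ j =
          (\<Sum>k\<in>UNIV. \<Sum>l\<in>UNIV.
             partial i (\<lambda>x. transition c d x $ k) (chart_map c p) *
             partial j (\<lambda>x. transition c d x $ l) (chart_map c p) *
             g d (chart_map d p) $ k $ l))"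


section \<open>Tensor calculus in local coordinates\<close>

text \<open>Here \<open>G\<close> is the component matrix of the metric in a fixed chart.\<close>

definition christoffel :: "'n::finite metric_comp \<Rightarrow> 'n \<Rightarrow> 'n \<Rightarrow> 'n \<Rightarrow> real^'n \<Rightarrow> real" where
  "christoffel G k i j x =
     (1/2) * (\<Sum>l\<in>UNIV. matrix_inv (G x) $ k $ l *
        (partial i (\<lambda>y. G y $ j $ l) x + partial j (\<lambda>y. G y $ i $ l) x
          - partial l (\<lambda>y. G y $ i $ j) x))"

text \<open>\<open>R(\<partial>\<^sub>i, \<partial>\<^sub>j) \<partial>\<^sub>k = (\<Sum>l. riemann G i j k l \<cdot> \<partial>\<^sub>l)\<close>, where
  \<open>R(X,Y)Z = \<nabla>\<^sub>X \<nabla>\<^sub>Y Z - \<nabla>\<^sub>Y \<nabla>\<^sub>X Z - \<nabla>\<^bsub>[X,Y]\<^esub> Z\<close>; round spheres have positive Ricci curvature.\<close>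

definition riemann :: "'n::finite metric_comp \<Rightarrow> 'n \<Rightarrow> 'n \<Rightarrow> 'n \<Rightarrow> 'n \<Rightarrow> real^'n \<Rightarrow> real" where
  "riemann G i j k l x =
     partial i (christoffel G l j k) x - partial j (christoffel G l i k) x
     + (\<Sum>m\<in>UNIV. christoffel G l i m x * christoffel G m j k x
                  - christoffel G l j m x * christoffel G m i k x)"

definition ricci :: "'n::finite metric_comp \<Rightarrow> 'n \<Rightarrow> 'n \<Rightarrow> real^'n \<Rightarrow> real" where
  "ricci G j k x = (\<Sum>l\<in>UNIV. riemann G l j k l x)"

definition scalar_curv :: "'n::finite metric_comp \<Rightarrow> real^'n \<Rightarrow> real" where
  "scalar_curv G x = (\<Sum>j\<in>UNIV. \<Sum>k\<in>UNIV. matrix_inv (G x) $ j $ k * ricci G j k x)"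

text \<open>\<open>cov_deriv2 G T i j k\<close> is \<open>\<nabla>\<^sub>i T\<^sub>j\<^sub>k\<close> for a covariant 2-tensor \<open>T\<close>.\<close>

definition cov_deriv2 :: "'n::finite metric_comp \<Rightarrow> ('n \<Rightarrow> 'n \<Rightarrow> real^'n \<Rightarrow> real) \<Rightarrow>
    'n \<Rightarrow> 'n \<Rightarrow> 'n \<Rightarrow> real^'n \<Rightarrow> real" where
  "cov_deriv2 G T i j k x =
     partial i (T j k) x
     - (\<Sum>m\<in>UNIV. christoffel G m i j x * T m k x + christoffel G m i k x * T j m x)"

definition hessian :: "'n::finite metric_comp \<Rightarrow> (real^'n \<Rightarrow> real) \<Rightarrow> 'n \<Rightarrow> 'n \<Rightarrow> real^'n \<Rightarrow> real" where
  "hessian G F i j x =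
     partial i (partial j F) x - (\<Sum>k\<in>UNIV. christoffel G k i j x * partial k F x)"

definition gradient :: "'n::finite metric_comp \<Rightarrow> (real^'n \<Rightarrow> real) \<Rightarrow> real^'n \<Rightarrow> real^'n" where
  "gradient G F x = (\<chi> k. \<Sum>l\<in>UNIV. matrix_inv (G x) $ k $ l * partial l F x)"

definition cotton :: "'n::finite metric_comp \<Rightarrow> 'n \<Rightarrow> 'n \<Rightarrow> 'n \<Rightarrow> real^'n \<Rightarrow> real" where
  "cotton G i j k x =
     cov_deriv2 G (ricci G) i j k x - cov_deriv2 G (ricci G) j i k x
     - 1 / (2 * (real CARD('n) - 1)) *
         (G x $ j $ k * partial i (scalar_curv G) x - G x $ i $ k * partial j (scalar_curv G) x)"

definition D_tensor ::
    "'n::finite metric_comp \<Rightarrow> (real^'n \<Rightarrow> real) \<Rightarrow> 'n \<Rightarrow> 'n \<Rightarrow> 'n \<Rightarrow> real^'n \<Rightarrow> real" where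
  "D_tensor G F i j k x =
     1 / (real CARD('n) - 2) * (ricci G j k x * partial i F x - ricci G i k x * partial j F x)
     + 1 / (2 * (real CARD('n) - 1) * (real CARD('n) - 2)) *
         (G x $ j $ k * partial i (scalar_curv G) x - G x $ i $ k * partial j (scalar_curv G) x)
     - scalar_curv G x / ((real CARD('n) - 1) * (real CARD('n) - 2)) *
         (G x $ j $ k * partial i F x - G x $ i $ k * partial j F x)"


section \<open>Completeness and gradient shrinking solitons\<close>

definition velocity :: "('a, 'n::finite) chart \<Rightarrow> (real \<Rightarrow> 'a) \<Rightarrow> real \<Rightarrow> real^'n" where
  "velocity c \<gamma> t = vector_derivative (chart_map c \<circ> \<gamma>) (at t)"

definition complete_geodesic ::
    "'a topology \<Rightarrow> ('a, 'n::finite) chart set \<Rightarrow> (('a, 'n) chart \<Rightarrow> 'n metric_comp) \<Rightarrow>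
     (real \<Rightarrow> 'a) \<Rightarrow> bool" where
  "complete_geodesic X A g \<gamma> \<longleftrightarrow>
     continuous_map euclideanreal X \<gamma> \<and>
     (\<forall>c\<in>A. \<forall>t. \<gamma> t \<in> chart_dom c \<longrightarrow>
        (chart_map c \<circ> \<gamma>) differentiable (at t) \<and>
        (velocity c \<gamma> has_vector_derivative
           (\<chi> k. - (\<Sum>i\<in>UNIV. \<Sum>j\<in>UNIV. christoffel (g c) k i j (chart_map c (\<gamma> t)) *
                     velocity c \<gamma> t $ i * velocity c \<gamma> t $ j))) (at t))"

text \<open>Completeness is geodesic completeness: every initial velocity at every point is that of a
  geodesic defined on the whole real line.\<close>

definition complete_riemannian_manifold ::
    "'a topology \<Rightarrow> ('a, 'n::finite) chart set \<Rightarrow> (('a, 'n) chart \<Rightarrow> 'n metric_comp) \<Rightarrow> bool" where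
  "complete_riemannian_manifold X A g \<longleftrightarrow>
     smooth_manifold X A \<and> riemannian_metric A g \<and>
     (\<forall>c\<in>A. \<forall>p\<in>chart_dom c. \<forall>v. \<exists>\<gamma>. complete_geodesic X A g \<gamma> \<and> \<gamma> 0 = p \<and> velocity c \<gamma> 0 = v)"

definition complete_gradient_shrinking_soliton ::
    "'a topology \<Rightarrow> ('a, 'n::finite) chart set \<Rightarrow> (('a, 'n) chart \<Rightarrow> 'n metric_comp) \<Rightarrow>
     ('a \<Rightarrow> real) \<Rightarrow> bool" where
  "complete_gradient_shrinking_soliton X A g f \<longleftrightarrow>
     complete_riemannian_manifold X A g \<and> smooth_function A f \<and>
     (\<forall>c\<in>A. \<forall>x\<in>chart_image c. \<forall>i j.
        ricci (g c) i j x + hessian (g c) (local_rep c f) i j x = (1/2) * g c x $ i $ j)"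

end

theory Submission
  imports Defs
begin

text \<open>Everything happens in one chart.  Write \<open>u = grad f\<close>, \<open>q = |u|\<^sup>2\<close>.  Tracing \<open>D = 0\<close> gives
  \<open>dR = 2 Ric(u, \<cdot>)\<close>; contracting \<open>D = 0\<close> with \<open>u\<close> and antisymmetrising then makes \<open>u\<close> an eigenvector
  of Ric, say with eigenvalue \<open>\<lambda>\<close>, and yields \<open>Ric = \<mu> g + \<nu> df \<otimes> df\<close> with differentiable \<open>\<mu>, \<nu>\<close> wherever
  \<open>u \<noteq> 0\<close>.  Since \<open>Ric = g/2 - Hess f\<close>, the Ricci identity turns
  \<open>S\<^sub>i\<^sub>j\<^sub>k = \<nabla>\<^sub>i R\<^sub>j\<^sub>k - \<nabla>\<^sub>j R\<^sub>i\<^sub>k\<close> into the contraction of the curvature tensor with \<open>df\<close>.  Hence \<open>S\<close> vanishes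
  when contracted with \<open>u\<close> in its last slot, and its trace over the last two slots is \<open>Ric(u, \<cdot>) = \<lambda> df\<close>.  Comparing
  with the derivative of \<open>\<mu> g + \<nu> df \<otimes> df\<close>, these two contractions give
  \<open>d\<mu> \<and> df + q d\<nu> \<and> df = 0\<close> and \<open>(n - 1) d\<mu> \<and> df + q d\<nu> \<and> df = 0\<close>, so \<open>d\<mu>\<close> and \<open>d\<nu>\<close> are multiples of \<open>df\<close>.
  Then \<open>S\<^sub>i\<^sub>j\<^sub>k = \<kappa> (f\<^sub>i g\<^sub>j\<^sub>k - f\<^sub>j g\<^sub>i\<^sub>k)\<close>, the trace forces \<open>\<kappa> = \<lambda>/(n - 1)\<close>, and this is exactly the
  scalar curvature term subtracted in the Cotton tensor.\<close>

section \<open>Calculus of smooth functions\<close>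

lemma smooth_on_differentiable: "smooth_on S F \<Longrightarrow> x \<in> S \<Longrightarrow> F differentiable at x"
  unfolding smooth_on_def by (metis Ck_on.simps(2))

lemma smooth_on_continuous: "smooth_on S F \<Longrightarrow> continuous_on S F"
  unfolding smooth_on_def by (metis Ck_on.simps(1))

lemma smooth_on_frechet_derivative:
  "smooth_on S F \<Longrightarrow> smooth_on S (\<lambda>x. frechet_derivative F (at x) v)"
  unfolding smooth_on_def by (metis Ck_on.simps(2))

lemma smooth_on_partial: "smooth_on S F \<Longrightarrow> smooth_on S (partial i F)"
  using smooth_on_frechet_derivative[of S F "axis i 1"] by (simp add: partial_def[abs_def])

text \<open>Both functions have the same set of derivatives at \<open>x\<close>, so the choice
  operator behind \<open>frechet_derivative\<close> picks the same map, also when that set is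
  empty.\<close>

lemma frechet_derivative_cong_open:
  assumes "open S" "x \<in> S" "\<And>y. y \<in> S \<Longrightarrow> F y = H y"
  shows "frechet_derivative F (at x) = frechet_derivative H (at x)"
proof -
  have "(F has_derivative D) (at x) \<longleftrightarrow> (H has_derivative D) (at x)" for D
    using has_derivative_transform_within_open[OF _ assms(1,2)] assms(3) by metis
  then show ?thesis
    by (simp add: frechet_derivative_def)
qed

lemma Ck_on_cong:
  assumes "open S" "\<And>y. y \<in> S \<Longrightarrow> F y = H y"
  shows "Ck_on k S F \<longleftrightarrow> Ck_on k S H"
  using assms(2)
proof (induction k arbitrary: F H)
  case 0
  then show ?case by (simp cong: continuous_on_cong)
next
  case (Suc k)
  have "F differentiable at x \<longleftrightarrow> H differentiable at x" if "x \<in> S" for x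
    using has_derivative_transform_within_open[OF _ assms(1) that] Suc.prems
    unfolding differentiable_def by metis
  moreover have "Ck_on k S (\<lambda>x. frechet_derivative F (at x) v) \<longleftrightarrow>
      Ck_on k S (\<lambda>x. frechet_derivative H (at x) v)" for v
    by (rule Suc.IH) (simp add: frechet_derivative_cong_open[OF assms(1) _ Suc.prems])
  ultimately show ?case by simp
qed

text \<open>A bounded linear map commutes with differentiation, so the directional derivatives of
  the composite are again of the form \<open>L\<close> after a function of class \<open>k\<close>.
  The purpose is to pass from a matrix-valued metric to its entries.\<close>

lemma Ck_on_bounded_linear:
  assumes "bounded_linear L" "open S" "Ck_on k S F"
  shows "Ck_on k S (\<lambda>x. L (F x))"
  using assms(3)
proof (induction k arbitrary: F)
  case 0
  then show ?case
    using assms(1) by (simp add: bounded_linear.continuous_on)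
next
  case (Suc k)
  have d: "((\<lambda>x. L (F x)) has_derivative (\<lambda>v. L (frechet_derivative F (at x) v))) (at x)"
    if "x \<in> S" for x
    using Suc.prems that
    by (intro bounded_linear.has_derivative[OF assms(1)]) (simp add: frechet_derivative_works)
  have "Ck_on k S (\<lambda>x. frechet_derivative (\<lambda>x. L (F x)) (at x) v)" for v
  proof -
    have "Ck_on k S (\<lambda>x. L (frechet_derivative F (at x) v))"
      using Suc by simp
    moreover have "L (frechet_derivative F (at x) v) = frechet_derivative (\<lambda>x. L (F x)) (at x) v"
      if "x \<in> S" for x
      using frechet_derivative_at[OF d[OF that]] by metis
    ultimately show ?thesis
      using Ck_on_cong[OF assms(2)] by (metis (no_types, lifting))
  qed
  then show ?case
    using d by (auto simp: differentiable_def)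
qed

lemma smooth_on_nth: "open S \<Longrightarrow> smooth_on S F \<Longrightarrow> smooth_on S (\<lambda>x. F x $ i)"
  unfolding smooth_on_def using Ck_on_bounded_linear[OF bounded_linear_vec_nth] by blast

lemma partial_eq: "(F has_derivative D) (at x) \<Longrightarrow> partial i F x = D (axis i 1)"
  by (metis frechet_derivative_at partial_def)

lemma partial_cong_open:
  assumes "open S" "x \<in> S" "\<And>y. y \<in> S \<Longrightarrow> F y = H y"
  shows "partial i F x = partial i H x"
  using frechet_derivative_cong_open[OF assms] by (simp add: partial_def)

lemma differentiable_cong_open:
  assumes "open S" "x \<in> S" "\<And>y. y \<in> S \<Longrightarrow> F y = H y" "H differentiable at x"
  shows "F differentiable at x"
  using has_derivative_transform_within_open[OF _ assms(1,2)] assms(3,4)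
  unfolding differentiable_def by metis

lemma partial_add:
  "F differentiable at x \<Longrightarrow> H differentiable at x \<Longrightarrow>
    partial i (\<lambda>y. F y + H y) x = partial i F x + partial i H x"
  by (subst partial_eq[OF has_derivative_add[OF frechet_derivative_works[THEN iffD1] frechet_derivative_works[THEN iffD1]]])
    (auto simp: partial_def)

lemma partial_diff:
  "F differentiable at x \<Longrightarrow> H differentiable at x \<Longrightarrow>
    partial i (\<lambda>y. F y - H y) x = partial i F x - partial i H x"
  by (subst partial_eq[OF has_derivative_diff[OF frechet_derivative_works[THEN iffD1] frechet_derivative_works[THEN iffD1]]])
    (auto simp: partial_def)

lemma partial_mult:
  "F differentiable at x \<Longrightarrow> H differentiable at x \<Longrightarrow>
    partial i (\<lambda>y. F y * H y) x = F x * partial i H x + partial i F x * H x"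
  by (subst partial_eq[OF has_derivative_mult[OF frechet_derivative_works[THEN iffD1] frechet_derivative_works[THEN iffD1]]])
    (auto simp: partial_def)

lemma partial_const: "partial i (\<lambda>y. c) x = 0"
  by (simp add: partial_def)

lemma partial_sum:
  "(\<And>j. j \<in> J \<Longrightarrow> F j differentiable at x) \<Longrightarrow>
    partial i (\<lambda>y. \<Sum>j\<in>J. F j y) x = (\<Sum>j\<in>J. partial i (F j) x)"
  by (subst partial_eq[OF has_derivative_sum[OF frechet_derivative_works[THEN iffD1]]])
    (auto simp: partial_def)

section \<open>Mean values and symmetry of second derivatives\<close>

lemma mvt_line:
  fixes F :: "'a::real_normed_vector \<Rightarrow> real"
  assumes "t > 0" "\<And>s. 0 \<le> s \<Longrightarrow> s \<le> t \<Longrightarrow> F differentiable at (p + s *\<^sub>R w)"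
  obtains s where "0 < s" "s < t"
    "F (p + t *\<^sub>R w) - F p = t * frechet_derivative F (at (p + s *\<^sub>R w)) w"
proof -
  have "((\<lambda>s. F (p + s *\<^sub>R w)) has_real_derivative frechet_derivative F (at (p + s *\<^sub>R w)) w) (at s)"
    if "0 \<le> s" "s \<le> t" for s
  proof -
    have D: "(F has_derivative frechet_derivative F (at (p + s *\<^sub>R w))) (at (p + s *\<^sub>R w))"
      using assms(2)[OF that] by (simp add: frechet_derivative_works)
    have "((\<lambda>s. p + s *\<^sub>R w) has_derivative (\<lambda>s. s *\<^sub>R w)) (at s)"
      by (auto intro!: derivative_eq_intros)
    from has_derivative_compose[OF this D]
    have "((\<lambda>s. F (p + s *\<^sub>R w)) has_derivative
        (\<lambda>r. frechet_derivative F (at (p + s *\<^sub>R w)) (r *\<^sub>R w))) (at s)" .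
    moreover have "frechet_derivative F (at (p + s *\<^sub>R w)) (r *\<^sub>R w) =
        frechet_derivative F (at (p + s *\<^sub>R w)) w * r" for r
      using linear_scale[OF linear_frechet_derivative[OF assms(2)[OF that]]]
      by (simp add: mult.commute)
    ultimately show ?thesis
      by (simp add: has_field_derivative_def)
  qed
  then have "\<exists>s>0. s < t \<and> F (p + t *\<^sub>R w) - F (p + 0 *\<^sub>R w) =
      (t - 0) * frechet_derivative F (at (p + s *\<^sub>R w)) w"
    by (rule MVT2[OF assms(1)])
  then show ?thesis using that by auto
qed

text \<open>The mixed second difference is the increment of \<open>?H\<close> along
  \<open>u\<close>; one mean value in direction \<open>u\<close> and then one in direction
  \<open>v\<close> turn it into a second derivative.\<close>

lemma second_difference_mvt:
  fixes F :: "'a::real_normed_vector \<Rightarrow> real"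
  assumes "t > 0" "smooth_on S F"
    and S: "\<And>r s. 0 \<le> r \<Longrightarrow> r \<le> t \<Longrightarrow> 0 \<le> s \<Longrightarrow> s \<le> t \<Longrightarrow> x + r *\<^sub>R u + s *\<^sub>R v \<in> S"
  obtains r s where "0 < r" "r < t" "0 < s" "s < t"
    "F (x + t *\<^sub>R u + t *\<^sub>R v) - F (x + t *\<^sub>R u) - F (x + t *\<^sub>R v) + F x =
      t * t * frechet_derivative (\<lambda>y. frechet_derivative F (at y) u) (at (x + r *\<^sub>R u + s *\<^sub>R v)) v"
proof -
  let ?H = "\<lambda>y. F (y + t *\<^sub>R v) - F y"
  have dF: "F differentiable at (x + r *\<^sub>R u + s *\<^sub>R v)" if "0 \<le> r" "r \<le> t" "0 \<le> s" "s \<le> t" for r s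
    using smooth_on_differentiable[OF assms(2) S[OF that]] .
  have H: "(?H has_derivative (\<lambda>w. frechet_derivative F (at (x + r *\<^sub>R u + t *\<^sub>R v)) w
      - frechet_derivative F (at (x + r *\<^sub>R u)) w)) (at (x + r *\<^sub>R u))"
    if "0 \<le> r" "r \<le> t" for r
  proof -
    have "((\<lambda>y. y + t *\<^sub>R v) has_derivative (\<lambda>w. w)) (at (x + r *\<^sub>R u))"
      by (auto intro!: derivative_eq_intros)
    moreover have "(F has_derivative frechet_derivative F (at (x + r *\<^sub>R u + t *\<^sub>R v)))
        (at (x + r *\<^sub>R u + t *\<^sub>R v))"
      using dF[of r t] that assms(1) by (simp add: frechet_derivative_works)
    ultimately have "((\<lambda>y. F (y + t *\<^sub>R v)) has_derivative
        (\<lambda>w. frechet_derivative F (at (x + r *\<^sub>R u + t *\<^sub>R v)) w)) (at (x + r *\<^sub>R u))"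
      by (rule has_derivative_compose)
    moreover have "(F has_derivative frechet_derivative F (at (x + r *\<^sub>R u))) (at (x + r *\<^sub>R u))"
      using dF[of r 0] that assms(1) by (simp add: frechet_derivative_works)
    ultimately show ?thesis by (rule has_derivative_diff)
  qed
  then have "?H differentiable at (x + r *\<^sub>R u)" if "0 \<le> r" "r \<le> t" for r
    using that unfolding differentiable_def by blast
  from mvt_line[OF assms(1) this] obtain r where r: "0 < r" "r < t"
    "?H (x + t *\<^sub>R u) - ?H x = t * frechet_derivative ?H (at (x + r *\<^sub>R u)) u" by blast
  let ?D = "\<lambda>y. frechet_derivative F (at y) u"
  have "frechet_derivative ?H (at (x + r *\<^sub>R u)) u = ?D (x + r *\<^sub>R u + t *\<^sub>R v) - ?D (x + r *\<^sub>R u)"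
    using fun_cong[OF frechet_derivative_at[OF H, of r], of u] r(1,2) by simp
  moreover have "?D differentiable at (x + r *\<^sub>R u + s *\<^sub>R v)" if "0 \<le> s" "s \<le> t" for s
    using smooth_on_differentiable[OF smooth_on_frechet_derivative[OF assms(2)] S] that r by simp
  from mvt_line[OF assms(1) this] obtain s where s: "0 < s" "s < t"
    "?D (x + r *\<^sub>R u + t *\<^sub>R v) - ?D (x + r *\<^sub>R u) =
       t * frechet_derivative ?D (at (x + r *\<^sub>R u + s *\<^sub>R v)) v" by blast
  ultimately have "F (x + t *\<^sub>R u + t *\<^sub>R v) - F (x + t *\<^sub>R u) - F (x + t *\<^sub>R v) + F x =
      t * t * frechet_derivative ?D (at (x + r *\<^sub>R u + s *\<^sub>R v)) v"
    using r(3) by (simp add: algebra_simps)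
  then show ?thesis by (rule that[OF r(1,2) s(1,2)])
qed

text \<open>The second difference is symmetric in \<open>u\<close> and \<open>v\<close>, so its two
  mean value forms agree on every small parallelogram at \<open>x\<close>. Shrinking the
  parallelogram and using continuity of the second derivatives carries the equality to
  \<open>x\<close>.\<close>

lemma second_derivative_symmetric:
  fixes F :: "'a::real_normed_vector \<Rightarrow> real"
  assumes "open S" "smooth_on S F" "x \<in> S"
  shows "frechet_derivative (\<lambda>y. frechet_derivative F (at y) u) (at x) v =
    frechet_derivative (\<lambda>y. frechet_derivative F (at y) v) (at x) u"
proof -
  define B where "B a b y = frechet_derivative (\<lambda>y. frechet_derivative F (at y) a) (at y) b" for a b y
  obtain e where e: "e > 0" "ball x e \<subseteq> S"
    using assms(1,3) by (meson openE)
  have c: "norm u + norm v + 1 > 0"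
    by (simp add: add_nonneg_pos)
  \<comment> \<open>The summand 1 makes the denominator positive even for \<open>u = v = 0\<close>
    and keeps the parallelogram strictly inside the ball.\<close>
  define t where "t n = e / (norm u + norm v + 1) / real (Suc n)" for n
  have t0: "t n > 0" for n
    using e(1) c by (simp add: t_def)
  have tle: "t n * (norm u + norm v) < e" for n
  proof -
    have "t n \<le> e / (norm u + norm v + 1)"
      using divide_left_mono[of 1 "real (Suc n)" "e / (norm u + norm v + 1)"] e(1) c
      by (simp add: t_def)
    then have "t n * (norm u + norm v) \<le> e / (norm u + norm v + 1) * (norm u + norm v)"
      by (intro mult_right_mono) auto
    also have "\<dots> < e"
      using e(1) c by (simp add: field_simps)
    finally show ?thesis .
  qed
  have close: "norm (r *\<^sub>R u + s *\<^sub>R v) \<le> t n * (norm u + norm v)"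
    if "0 \<le> r" "r \<le> t n" "0 \<le> s" "s \<le> t n" for r s n
  proof -
    have "norm (r *\<^sub>R u + s *\<^sub>R v) \<le> r * norm u + s * norm v"
      using norm_triangle_ineq[of "r *\<^sub>R u" "s *\<^sub>R v"] that by simp
    also have "\<dots> \<le> t n * norm u + t n * norm v"
      using that by (intro add_mono mult_right_mono) auto
    finally show ?thesis by (simp add: algebra_simps)
  qed
  have inS: "x + r *\<^sub>R u + s *\<^sub>R v \<in> S" "x + r *\<^sub>R v + s *\<^sub>R u \<in> S"
    if "0 \<le> r" "r \<le> t n" "0 \<le> s" "s \<le> t n" for r s n
  proof -
    have "dist x (x + r *\<^sub>R u + s *\<^sub>R v) < e" "dist x (x + r *\<^sub>R v + s *\<^sub>R u) < e"
      using close[OF that] close[OF that(3,4,1,2)] tle[of n]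
      by (auto simp: dist_norm norm_minus_commute algebra_simps)
    then show "x + r *\<^sub>R u + s *\<^sub>R v \<in> S" "x + r *\<^sub>R v + s *\<^sub>R u \<in> S"
      using e(2) by auto
  qed
  have "\<exists>p q. p \<in> S \<and> q \<in> S \<and> dist p x \<le> t n * (norm u + norm v) \<and> dist q x \<le> t n * (norm u + norm v) \<and>
      B u v p = B v u q" for n
  proof -
    obtain r s where 1: "0 < r" "r < t n" "0 < s" "s < t n"
      "F (x + t n *\<^sub>R u + t n *\<^sub>R v) - F (x + t n *\<^sub>R u) - F (x + t n *\<^sub>R v) + F x =
        t n * t n * B u v (x + r *\<^sub>R u + s *\<^sub>R v)"
      unfolding B_def by (rule second_difference_mvt[OF t0[of n] assms(2) inS(1)])
    obtain r' s' where 2: "0 < r'" "r' < t n" "0 < s'" "s' < t n"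
      "F (x + t n *\<^sub>R v + t n *\<^sub>R u) - F (x + t n *\<^sub>R v) - F (x + t n *\<^sub>R u) + F x =
        t n * t n * B v u (x + r' *\<^sub>R v + s' *\<^sub>R u)"
      unfolding B_def by (rule second_difference_mvt[OF t0[of n] assms(2) inS(2)])
    have "t n * t n * B u v (x + r *\<^sub>R u + s *\<^sub>R v) = t n * t n * B v u (x + r' *\<^sub>R v + s' *\<^sub>R u)"
      using 1(5) 2(5) by (simp add: algebra_simps)
    then have "B u v (x + r *\<^sub>R u + s *\<^sub>R v) = B v u (x + r' *\<^sub>R v + s' *\<^sub>R u)"
      using t0[of n] by simp
    moreover have "dist (x + r *\<^sub>R u + s *\<^sub>R v) x \<le> t n * (norm u + norm v)"
      "dist (x + r' *\<^sub>R v + s' *\<^sub>R u) x \<le> t n * (norm u + norm v)"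
      using close[of r n s] close[of s' n r'] 1 2 by (auto simp: dist_norm algebra_simps)
    ultimately show ?thesis
      using inS(1)[of r n s] inS(2)[of r' n s'] 1 2 by (meson less_imp_le)
  qed
  then obtain p q where pq: "\<And>n. p n \<in> S" "\<And>n. q n \<in> S"
    "\<And>n. dist (p n) x \<le> t n * (norm u + norm v)" "\<And>n. dist (q n) x \<le> t n * (norm u + norm v)"
    "\<And>n. B u v (p n) = B v u (q n)"
    by metis
  have "(\<lambda>n. e / (norm u + norm v + 1) * (norm u + norm v) * inverse (real (Suc n))) \<longlonglongrightarrow>
      e / (norm u + norm v + 1) * (norm u + norm v) * 0"
    by (intro tendsto_intros LIMSEQ_inverse_real_of_nat)
  then have lim0: "(\<lambda>n. t n * (norm u + norm v)) \<longlonglongrightarrow> 0"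
    by (simp add: t_def divide_inverse algebra_simps)
  have p: "p \<longlonglongrightarrow> x" and q: "q \<longlonglongrightarrow> x"
    using tendsto_sandwich[OF _ _ tendsto_const lim0, of "\<lambda>n. dist (p n) x"]
      tendsto_sandwich[OF _ _ tendsto_const lim0, of "\<lambda>n. dist (q n) x"] pq(3,4)
    by (auto simp: tendsto_dist_iff[of p] tendsto_dist_iff[of q])
  have cont: "continuous_on S (B a b)" for a b
    unfolding B_def[abs_def]
    by (intro smooth_on_continuous smooth_on_frechet_derivative assms(2))
  have "(\<lambda>n. B u v (p n)) \<longlonglongrightarrow> B u v x" "(\<lambda>n. B v u (q n)) \<longlonglongrightarrow> B v u x"
    using continuous_on_tendsto_compose[OF cont p assms(3)]
      continuous_on_tendsto_compose[OF cont q assms(3)] pq(1,2) by simp_all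
  then have "B u v x = B v u x"
    using LIMSEQ_unique pq(5) by simp
  then show ?thesis by (simp add: B_def)
qed

lemma partial_commute:
  assumes "open S" "smooth_on S F" "x \<in> S"
  shows "partial i (partial j F) x = partial j (partial i F) x"
  using second_derivative_symmetric[OF assms] by (simp add: partial_def[abs_def])

section \<open>Differentiability of determinants and inverse matrices\<close>

lemma differentiable_det:
  fixes M :: "'a::real_normed_vector \<Rightarrow> real^'n^'n"
  assumes "\<And>i j. (\<lambda>y. M y $ i $ j) differentiable at x"
  shows "(\<lambda>y. det (M y)) differentiable at x"
proof -
  have "(\<lambda>y. \<Prod>i\<in>I. M y $ i $ p i) differentiable at x" if "finite I" for I :: "'n set" and p :: "'n \<Rightarrow> 'n"
    using that by induction (auto intro!: differentiable_mult assms)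
  then show ?thesis
    unfolding det_def
    by (intro differentiable_sum differentiable_mult differentiable_const ballI) auto
qed

text \<open>Cramer's rule writes an entry of the inverse as a quotient of determinants.
  Invertibility on a whole neighbourhood lets this formula be differentiated.\<close>

lemma differentiable_matrix_inv:
  fixes M :: "'a::real_normed_vector \<Rightarrow> real^'n^'n"
  assumes "open S" "x \<in> S" "\<And>y. y \<in> S \<Longrightarrow> invertible (M y)"
    and M: "\<And>i j. (\<lambda>y. M y $ i $ j) differentiable at x"
  shows "(\<lambda>y. matrix_inv (M y) $ k $ l) differentiable at x"
proof (rule differentiable_cong_open[OF assms(1,2)])
  \<comment> \<open>\<open>M y\<close> with column \<open>k\<close> replaced by the basis vector
    \<open>axis l 1\<close>.\<close>
  let ?N = "\<lambda>y. (\<chi> i j. if j = k then axis l 1 $ i else M y $ i $ j) :: real^'n^'n"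
  show "matrix_inv (M y) $ k $ l = det (?N y) / det (M y)" if "y \<in> S" for y
  proof -
    have "M y ** matrix_inv (M y) = mat 1"
      using assms(3)[OF that] unfolding invertible_def matrix_inv_def by (rule someI2_ex) simp
    then have "M y *v (matrix_inv (M y) *v axis l 1) = axis l 1"
      by (simp add: matrix_vector_mul_assoc)
    then have "(matrix_inv (M y) *v axis l 1) $ k = det (?N y) / det (M y)"
      using cramer[of "M y"] assms(3)[OF that] by (simp add: invertible_det_nz)
    then show ?thesis
      by (simp add: matrix_vector_mult_basis column_def)
  qed
  have "(\<lambda>y. ?N y $ i $ j) differentiable at x" for i j
    using M by (cases "j = k") simp_all
  then show "(\<lambda>y. det (?N y) / det (M y)) differentiable at x"
    using assms(2,3) by (intro differentiable_divide differentiable_det M) (auto simp: invertible_det_nz)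
qed

section \<open>Curvature identities in a chart\<close>

locale metric_chart =
  fixes U :: "(real^'n::finite) set" and G :: "'n metric_comp"
  assumes open_U: "open U"
    and smooth_G: "smooth_on U G"
    and transpose_G: "\<And>x. x \<in> U \<Longrightarrow> transpose (G x) = G x"
    and pos_G: "\<And>x v. x \<in> U \<Longrightarrow> v \<noteq> 0 \<Longrightarrow> v \<bullet> (G x *v v) > 0"
begin

section \<open>Inverse metric, Christoffel symbols and metric compatibility\<close>

abbreviation "ginv k l x \<equiv> matrix_inv (G x) $ k $ l"
abbreviation "\<Gamma> \<equiv> christoffel G"

lemma G_sym: "x \<in> U \<Longrightarrow> G x $ i $ j = G x $ j $ i"
  using arg_cong[OF transpose_G[of x], of "\<lambda>M. M $ j $ i"] by (simp add: transpose_def)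

text \<open>A nonzero kernel vector would violate positive definiteness.\<close>

lemma invertible_G: "x \<in> U \<Longrightarrow> invertible (G x)"
  unfolding invertible_left_inverse matrix_left_invertible_ker
  by (metis inner_zero_right less_irrefl pos_G)

lemma matrix_inv_G:
  assumes "x \<in> U"
  shows "G x ** matrix_inv (G x) = mat 1" "matrix_inv (G x) ** G x = mat 1"
  using someI_ex[OF invertible_G[OF assms, unfolded invertible_def]]
  by (simp_all add: matrix_inv_def)

lemma ginv_sym:
  assumes "x \<in> U"
  shows "ginv k l x = ginv l k x"
proof -
  let ?B = "matrix_inv (G x)"
  have "transpose ?B ** G x = transpose (G x ** ?B)"
    by (simp add: matrix_transpose_mul transpose_G[OF assms])
  also have "\<dots> = mat 1"
    by (simp add: matrix_inv_G[OF assms] transpose_mat)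
  finally have "transpose ?B = ?B"
    by (metis matrix_inv_G(1)[OF assms] matrix_mul_assoc matrix_mul_lid matrix_mul_rid)
  from arg_cong[OF this, of "\<lambda>M. M $ l $ k"] show ?thesis
    by (simp add: transpose_def)
qed

lemma G_ginv: "x \<in> U \<Longrightarrow> (\<Sum>m\<in>UNIV. G x $ i $ m * ginv m j x) = (if i = j then 1 else 0)"
  using arg_cong[OF matrix_inv_G(1), of x "\<lambda>M. M $ i $ j"]
  by (simp add: matrix_matrix_mult_def mat_def)

lemma ginv_G: "x \<in> U \<Longrightarrow> (\<Sum>m\<in>UNIV. ginv i m x * G x $ m $ j) = (if i = j then 1 else 0)"
  using arg_cong[OF matrix_inv_G(2), of x "\<lambda>M. M $ i $ j"]
  by (simp add: matrix_matrix_mult_def mat_def)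

lemma smooth_G_nth: "smooth_on U (\<lambda>y. G y $ i $ j)"
  using smooth_on_nth[OF open_U smooth_on_nth[OF open_U smooth_G]] .

lemma diff_G: "x \<in> U \<Longrightarrow> (\<lambda>y. G y $ i $ j) differentiable at x"
  using smooth_on_differentiable[OF smooth_G_nth] .

lemma diff_partial_G: "x \<in> U \<Longrightarrow> partial k (\<lambda>y. G y $ i $ j) differentiable at x"
  using smooth_on_differentiable[OF smooth_on_partial[OF smooth_G_nth]] .

lemma diff_ginv: "x \<in> U \<Longrightarrow> ginv k l differentiable at x"
  by (rule differentiable_matrix_inv[OF open_U]) (auto intro: invertible_G diff_G)

lemma diff_christoffel: "x \<in> U \<Longrightarrow> \<Gamma> k i j differentiable at x"
  unfolding christoffel_def[abs_def]
  by (intro differentiable_mult differentiable_sum differentiable_add differentiable_diff ballI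
      differentiable_const diff_ginv diff_partial_G) auto

lemma partial_G_sym: "x \<in> U \<Longrightarrow> partial k (\<lambda>y. G y $ i $ j) x = partial k (\<lambda>y. G y $ j $ i) x"
  by (rule partial_cong_open[OF open_U]) (auto intro: G_sym)

lemma christoffel_sym: "x \<in> U \<Longrightarrow> \<Gamma> k i j x = \<Gamma> k j i x"
  unfolding christoffel_def by (simp add: partial_G_sym[of x _ i j] add.commute)

text \<open>Lowering the upper index cancels the inverse metric and leaves the Christoffel symbols
  of the first kind.\<close>

lemma christoffel_lower:
  assumes "x \<in> U"
  shows "(\<Sum>m\<in>UNIV. \<Gamma> m i j x * G x $ m $ k) = (1/2) * (partial i (\<lambda>y. G y $ j $ k) x
    + partial j (\<lambda>y. G y $ i $ k) x - partial k (\<lambda>y. G y $ i $ j) x)"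
proof -
  let ?A = "\<lambda>l. partial i (\<lambda>y. G y $ j $ l) x + partial j (\<lambda>y. G y $ i $ l) x
    - partial l (\<lambda>y. G y $ i $ j) x"
  have "(\<Sum>m\<in>UNIV. \<Gamma> m i j x * G x $ m $ k) =
      (\<Sum>m\<in>UNIV. \<Sum>l\<in>UNIV. (1/2) * ?A l * (ginv l m x * G x $ m $ k))"
    by (simp add: christoffel_def sum_distrib_left sum_distrib_right ginv_sym[OF assms] mult_ac)
  also have "\<dots> = (\<Sum>l\<in>UNIV. (1/2) * ?A l * (\<Sum>m\<in>UNIV. ginv l m x * G x $ m $ k))"
    by (subst sum.swap) (simp add: sum_distrib_left)
  also have "\<dots> = (1/2) * ?A k"
    by (simp only: ginv_G[OF assms]) (simp add: if_distrib[of "(*) _"] cong: if_cong)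
  finally show ?thesis .
qed

text \<open>In the sum of the two symbols of the first kind, all but the derivative along
  \<open>i\<close> cancels. This form serves as a rewrite rule for derivatives of the
  metric.\<close>

lemma metric_compatible:
  assumes "x \<in> U"
  shows "partial i (\<lambda>y. G y $ j $ k) x =
    (\<Sum>m\<in>UNIV. \<Gamma> m i j x * G x $ m $ k + \<Gamma> m i k x * G x $ m $ j)"
  unfolding sum.distrib christoffel_lower[OF assms]
  by (simp add: partial_G_sym[OF assms, of i k j] field_simps)

lemma cov_deriv_G: "x \<in> U \<Longrightarrow> cov_deriv2 G (\<lambda>j k y. G y $ j $ k) i j k x = 0"
  by (simp add: cov_deriv2_def metric_compatible G_sym[of x j])

section \<open>Skew symmetries of the curvature and the Ricci identity\<close>

lemma riemann_swap: "riemann G i j k l x = - riemann G j i k l x"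
  by (simp add: riemann_def sum_subtractf)

text \<open>The commutator of two coordinate derivatives of \<open>G y $ k $ l\<close> vanishes.
  Expanded by metric compatibility, it is the sum of the two lowered curvature terms.\<close>

lemma riemann_lower_antisym:
  assumes x: "x \<in> U"
  shows "(\<Sum>m\<in>UNIV. riemann G i j k m x * G x $ m $ l) = - (\<Sum>m\<in>UNIV. riemann G i j l m x * G x $ m $ k)"
proof -
  \<comment> \<open>\<open>X\<close> and \<open>Y\<close> are the terms that make up the curvature.
    \<open>Z\<close> is invariant under exchanging \<open>i\<close> with \<open>j\<close> and
    \<open>k\<close> with \<open>l\<close> together, so it drops out of the commutator.\<close>
  define X where "X i j k l = (\<Sum>m\<in>UNIV. partial i (\<Gamma> m j k) x * G x $ m $ l)" for i j k l
  define Y where "Y i j k l = (\<Sum>m\<in>UNIV. \<Sum>p\<in>UNIV. \<Gamma> m j k x * \<Gamma> p i m x * G x $ p $ l)" for i j k l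
  define Z where "Z i j k l = (\<Sum>m\<in>UNIV. \<Sum>p\<in>UNIV. \<Gamma> m j k x * \<Gamma> p i l x * G x $ p $ m)" for i j k l
  have ddG: "partial i (partial j (\<lambda>y. G y $ k $ l)) x =
      X i j k l + X i j l k + Y i j k l + Y i j l k + Z i j k l + Z i j l k" for i j k l
  proof -
    have "partial i (partial j (\<lambda>y. G y $ k $ l)) x =
        partial i (\<lambda>y. \<Sum>m\<in>UNIV. \<Gamma> m j k y * G y $ m $ l + \<Gamma> m j l y * G y $ m $ k) x"
      by (rule partial_cong_open[OF open_U x metric_compatible])
    also have "\<dots> = (\<Sum>m\<in>UNIV. (\<Gamma> m j k x * partial i (\<lambda>y. G y $ m $ l) x + partial i (\<Gamma> m j k) x * G x $ m $ l)
        + (\<Gamma> m j l x * partial i (\<lambda>y. G y $ m $ k) x + partial i (\<Gamma> m j l) x * G x $ m $ k))"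
      by (simp add: partial_sum partial_add partial_mult diff_christoffel[OF x] diff_G[OF x]
          differentiable_add differentiable_mult)
    also have "\<dots> = X i j k l + X i j l k + Y i j k l + Y i j l k + Z i j k l + Z i j l k"
      unfolding metric_compatible[OF x] X_def Y_def Z_def
      by (simp add: sum.distrib sum_distrib_left distrib_left mult.assoc)
    finally show ?thesis .
  qed
  have Z: "Z i j k l = Z j i l k" for i j k l
    unfolding Z_def by (subst sum.swap) (simp add: G_sym[OF x] mult_ac)
  have R: "(\<Sum>m\<in>UNIV. riemann G i j k m x * G x $ m $ l) = X i j k l - X j i k l + Y i j k l - Y j i k l"
    for i j k l
  proof -
    have "Y i j k l = (\<Sum>m\<in>UNIV. \<Sum>p\<in>UNIV. \<Gamma> m i p x * \<Gamma> p j k x * G x $ m $ l)" for i j k l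
      unfolding Y_def by (subst sum.swap) (simp add: mult_ac)
    then show ?thesis
      by (simp add: X_def riemann_def algebra_simps sum.distrib sum_subtractf sum_distrib_left)
  qed
  have "partial i (partial j (\<lambda>y. G y $ k $ l)) x = partial j (partial i (\<lambda>y. G y $ k $ l)) x"
    by (rule partial_commute[OF open_U smooth_G_nth x])
  then show ?thesis
    unfolding R ddG using Z[of i j k l] Z[of i j l k] by linarith
qed

lemma diff_hessian:
  assumes "smooth_on U F" "x \<in> U"
  shows "hessian G F i j differentiable at x"
  unfolding hessian_def[abs_def]
  by (intro differentiable_diff differentiable_sum differentiable_mult ballI finite
      diff_christoffel[OF assms(2)] smooth_on_differentiable[OF _ assms(2)] smooth_on_partial assms(1))

lemma hessian_sym: "smooth_on U F \<Longrightarrow> x \<in> U \<Longrightarrow> hessian G F i j x = hessian G F j i x"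
  unfolding hessian_def by (simp add: partial_commute[OF open_U, of F x i j] christoffel_sym[of x _ i j])

text \<open>The Hessian is the covariant derivative of \<open>dF\<close>, so this is the commutator
  of covariant derivatives on a one-form; the minus sign comes from the dual action of the
  curvature.\<close>

lemma ricci_identity:
  assumes F: "smooth_on U F" and x: "x \<in> U"
  shows "cov_deriv2 G (hessian G F) i j k x - cov_deriv2 G (hessian G F) j i k x =
    - (\<Sum>l\<in>UNIV. riemann G i j k l x * partial l F x)"
proof -
  have dF: "partial l F differentiable at x" "partial k (partial l F) differentiable at x" for k l
    by (intro smooth_on_differentiable[OF _ x] smooth_on_partial F)+
  \<comment> \<open>After skew-symmetrising in \<open>i\<close> and \<open>j\<close>, the
    \<open>Q\<close> terms cancel and \<open>P\<close> and \<open>W\<close> assemble the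
    curvature.\<close>
  define P where "P i j k = (\<Sum>l\<in>UNIV. partial i (\<Gamma> l j k) x * partial l F x)" for i j k
  define Q where "Q i j k = (\<Sum>l\<in>UNIV. \<Gamma> l j k x * partial i (partial l F) x)" for i j k
  define W where "W i j k = (\<Sum>m\<in>UNIV. \<Sum>l\<in>UNIV. \<Gamma> m i k x * \<Gamma> l j m x * partial l F x)" for i j k
  have d: "partial i (hessian G F j k) x = partial i (partial j (partial k F)) x - (P i j k + Q i j k)" for i j k
    unfolding hessian_def[abs_def] P_def Q_def
    by (simp add: partial_diff partial_sum partial_mult dF diff_christoffel[OF x] differentiable_mult
        sum.distrib[symmetric] add.commute)
  have c1: "(\<Sum>m\<in>UNIV. \<Gamma> m i k x * hessian G F j m x) = Q j i k - W i j k" for i j k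
    unfolding hessian_def Q_def W_def
    by (simp add: right_diff_distrib sum_subtractf sum_distrib_left mult.assoc)
  have c: "cov_deriv2 G (hessian G F) i j k x = partial i (partial j (partial k F)) x
      - (P i j k + Q i j k) - (\<Sum>m\<in>UNIV. \<Gamma> m i j x * hessian G F m k x) - (Q j i k - W i j k)" for i j k
    unfolding cov_deriv2_def sum.distrib d c1 by simp
  have "W i j k = (\<Sum>l\<in>UNIV. \<Sum>m\<in>UNIV. \<Gamma> l j m x * \<Gamma> m i k x * partial l F x)" for i j k
    unfolding W_def by (subst sum.swap) (simp add: mult_ac)
  then have "(\<Sum>l\<in>UNIV. riemann G i j k l x * partial l F x) = P i j k - P j i k + W j i k - W i j k"
    by (simp add: P_def riemann_def algebra_simps sum.distrib sum_subtractf sum_distrib_left)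
  moreover have "partial i (partial j (partial k F)) x = partial j (partial i (partial k F)) x"
    by (rule partial_commute[OF open_U smooth_on_partial[OF F] x])
  ultimately show ?thesis
    unfolding c by (simp add: christoffel_sym[OF x, of _ i j])
qed

end

section \<open>Gradient shrinking solitons with vanishing D-tensor\<close>

locale D_flat_shrinker_chart = metric_chart U G
  for U :: "(real^'n::finite) set" and G :: "'n metric_comp" +
  fixes F :: "real^'n \<Rightarrow> real"
  assumes dim: "CARD('n) \<ge> 3"
    and smooth_F: "smooth_on U F"
    and soliton: "\<And>x i j. x \<in> U \<Longrightarrow> ricci G i j x + hessian G F i j x = (1/2) * G x $ i $ j"
    and D_zero: "\<And>x i j k. x \<in> U \<Longrightarrow> D_tensor G F i j k x = 0"
begin

section \<open>Contraction with the gradient and metric trace\<close>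

text \<open>A covector evaluated on the gradient vector; on the differential of \<open>F\<close> it
  gives the squared length of the gradient.\<close>

definition con :: "real^'n \<Rightarrow> ('n \<Rightarrow> real) \<Rightarrow> real" where
  "con x a = (\<Sum>k\<in>UNIV. a k * gradient G F x $ k)"

definition tr :: "real^'n \<Rightarrow> ('n \<Rightarrow> 'n \<Rightarrow> real) \<Rightarrow> real" where
  "tr x T = (\<Sum>j\<in>UNIV. \<Sum>k\<in>UNIV. ginv j k x * T j k)"

text \<open>\<open>eigval\<close> is the Ricci eigenvalue in the direction of the gradient of \<open>F\<close>, and \<open>mu\<close> the one on its
  orthogonal complement; both are junk where the gradient vanishes.\<close>

definition "eigval x = con x (\<lambda>j. con x (\<lambda>k. ricci G j k x)) / con x (\<lambda>k. partial k F x)"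
definition "mu x = (scalar_curv G x - eigval x) / (real CARD('n) - 1)"
definition "nu x = (eigval x - mu x) / con x (\<lambda>k. partial k F x)"

lemma con_linear:
  "con x (\<lambda>k. a k + b k) = con x a + con x b"
  "con x (\<lambda>k. a k - b k) = con x a - con x b"
  "con x (\<lambda>k. c * a k) = c * con x a"
  by (simp_all add: con_def sum.distrib sum_subtractf sum_distrib_left algebra_simps)

lemma tr_linear:
  "tr x (\<lambda>j k. T j k + S j k) = tr x T + tr x S"
  "tr x (\<lambda>j k. T j k - S j k) = tr x T - tr x S"
  "tr x (\<lambda>j k. c * T j k) = c * tr x T"
  by (simp_all add: tr_def sum.distrib sum_subtractf sum_distrib_left algebra_simps)

lemma tr_ricci: "tr x (\<lambda>j k. ricci G j k x) = scalar_curv G x"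
  by (simp add: tr_def scalar_curv_def)

lemma gradient_nth: "gradient G F x $ k = (\<Sum>l\<in>UNIV. ginv k l x * partial l F x)"
  by (simp add: gradient_def)

text \<open>Lowering the index of the gradient returns the differential.\<close>

lemma con_G: "x \<in> U \<Longrightarrow> con x (\<lambda>k. G x $ i $ k) = partial i F x"
proof -
  assume x: "x \<in> U"
  have "con x (\<lambda>k. G x $ i $ k) = (\<Sum>k\<in>UNIV. \<Sum>l\<in>UNIV. G x $ i $ k * ginv k l x * partial l F x)"
    by (simp add: con_def gradient_nth sum_distrib_left mult.assoc)
  also have "\<dots> = (\<Sum>l\<in>UNIV. (\<Sum>k\<in>UNIV. G x $ i $ k * ginv k l x) * partial l F x)"
    by (subst sum.swap) (simp add: sum_distrib_right)
  also have "\<dots> = partial i F x"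
    by (simp add: G_ginv[OF x] if_distrib[of "\<lambda>c. c * _"] cong: if_cong)
  finally show ?thesis .
qed

lemma tr_G: "x \<in> U \<Longrightarrow> tr x (\<lambda>j k. G x $ j $ k) = real CARD('n)"
  using ginv_G[of x] by (simp add: tr_def G_sym[of x])

lemma tr_G_row:
  assumes "x \<in> U"
  shows "tr x (\<lambda>j k. a j * G x $ i $ k) = a i"
proof -
  have "tr x (\<lambda>j k. a j * G x $ i $ k) = (\<Sum>j\<in>UNIV. a j * (\<Sum>k\<in>UNIV. ginv j k x * G x $ k $ i))"
    by (simp add: tr_def sum_distrib_left G_sym[OF assms, of i] mult_ac)
  also have "\<dots> = a i"
    by (simp add: ginv_G[OF assms] if_distrib[of "(*) _"] cong: if_cong)
  finally show ?thesis .
qed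

lemma tr_partial_left:
  assumes "x \<in> U"
  shows "tr x (\<lambda>j k. partial j F x * a k) = con x a"
  unfolding tr_def con_def gradient_nth
  by (subst sum.swap) (simp add: sum_distrib_left ginv_sym[OF assms] mult_ac)

lemma tr_partial_right: "tr x (\<lambda>j k. a j * partial k F x) = con x a"
  unfolding tr_def con_def gradient_nth by (simp add: sum_distrib_left mult_ac)

lemma gradient_nonzero_iff:
  assumes "x \<in> U"
  shows "gradient G F x \<noteq> 0 \<longleftrightarrow> (\<exists>i. partial i F x \<noteq> 0)"
proof
  assume "gradient G F x \<noteq> 0"
  then show "\<exists>i. partial i F x \<noteq> 0"
    by (rule contrapos_np) (simp add: vec_eq_iff gradient_nth)
next
  assume "\<exists>i. partial i F x \<noteq> 0"
  then show "gradient G F x \<noteq> 0"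
    using con_G[OF assms] by (auto simp: con_def)
qed

text \<open>Positive definiteness applied to the gradient itself, whose image under
  \<open>G x\<close> is the differential of \<open>F\<close>.\<close>

lemma norm_gradient_pos:
  assumes "x \<in> U" "gradient G F x \<noteq> 0"
  shows "con x (\<lambda>k. partial k F x) > 0"
proof -
  have "(G x *v gradient G F x) $ i = partial i F x" for i
    using con_G[OF assms(1), of i] by (simp add: con_def matrix_vector_mult_def)
  then show ?thesis
    using pos_G[OF assms] by (simp add: inner_vec_def con_def mult.commute)
qed

section \<open>Symmetry and regularity of the Ricci tensor\<close>

lemma ricci_hessian: "x \<in> U \<Longrightarrow> ricci G i j x = (1/2) * G x $ i $ j - hessian G F i j x"
  using soliton[of x i j] by simp

lemma ricci_sym: "x \<in> U \<Longrightarrow> ricci G i j x = ricci G j i x"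
  by (simp add: ricci_hessian hessian_sym[OF smooth_F, of x i j] G_sym[of x i j])

lemma diff_partial_F: "x \<in> U \<Longrightarrow> partial i F differentiable at x"
  by (rule smooth_on_differentiable[OF smooth_on_partial[OF smooth_F]])

text \<open>Through the soliton equation Ricci contains the Christoffel symbols undifferentiated, so
  one derivative of them suffices.\<close>

lemma diff_ricci:
  assumes "x \<in> U"
  shows "ricci G i j differentiable at x"
  by (rule differentiable_cong_open[OF open_U assms ricci_hessian], assumption)
    (intro differentiable_diff differentiable_mult differentiable_const diff_G diff_hessian
      smooth_F assms)

lemma diff_con:
  assumes "x \<in> U" "\<And>k. a k differentiable at x"
  shows "(\<lambda>y. con y (\<lambda>k. a k y)) differentiable at x"
  unfolding con_def gradient_nth
  by (intro differentiable_sum differentiable_mult ballI finite assms(2) diff_ginv diff_partial_F assms(1))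

text \<open>The explicit quotients defining the eigenvalues are differentiable because the squared
  gradient length in the denominator is positive at \<open>x\<close>.\<close>

lemma diff_mu_nu:
  assumes x: "x \<in> U" and g: "gradient G F x \<noteq> 0"
  shows "mu differentiable at x" "nu differentiable at x"
proof -
  have q: "(\<lambda>y. con y (\<lambda>k. partial k F y)) differentiable at x"
    by (intro diff_con x diff_partial_F)
  have e: "eigval differentiable at x"
    unfolding eigval_def[abs_def]
    using norm_gradient_pos[OF x g] by (intro differentiable_divide q diff_con x diff_ricci) simp
  have "scalar_curv G differentiable at x"
    unfolding scalar_curv_def[abs_def]
    by (intro differentiable_sum differentiable_mult ballI finite diff_ginv diff_ricci x)
  then show m: "mu differentiable at x"
    unfolding mu_def[abs_def] using dim
    by (intro differentiable_divide differentiable_diff e differentiable_const) auto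
  show "nu differentiable at x"
    unfolding nu_def[abs_def]
    using norm_gradient_pos[OF x g] by (intro differentiable_divide differentiable_diff e m q) simp
qed

section \<open>Algebraic consequences of the vanishing D-tensor\<close>

text \<open>Each summand is bracketed as a factor times a tensor, so that \<open>tr_linear\<close>,
  \<open>tr_G_row\<close> and \<open>tr_partial_left\<close> apply by rewriting.\<close>

lemma D_zero_cleared:
  assumes "x \<in> U"
  shows "(2 * (real CARD('n) - 1) * partial i F x) * ricci G j k x - 2 * (real CARD('n) - 1) * (partial j F x * ricci G i k x)
    + partial i (scalar_curv G) x * G x $ j $ k - partial j (scalar_curv G) x * G x $ i $ k
    - (2 * scalar_curv G x * partial i F x) * G x $ j $ k
    + 2 * scalar_curv G x * (partial j F x * G x $ i $ k) = 0"
proof -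
  have clear: "2 * p * a + b - 2 * R * c = 0"
    if "p \<noteq> 0" "m \<noteq> 0" "1 / m * a + 1 / (2 * p * m) * b - R / (p * m) * c = 0" for p m a b c R :: real
  proof -
    have "2 * p * a + b - 2 * R * c = 2 * p * m * (1 / m * a + 1 / (2 * p * m) * b - R / (p * m) * c)"
      using that(1,2) by (simp add: field_simps)
    then show ?thesis using that(3) by simp
  qed
  have "real CARD('n) - 1 \<noteq> 0" "real CARD('n) - 2 \<noteq> 0" using dim by auto
  then have "2 * (real CARD('n) - 1) * (ricci G j k x * partial i F x - ricci G i k x * partial j F x)
    + (G x $ j $ k * partial i (scalar_curv G) x - G x $ i $ k * partial j (scalar_curv G) x)
    - 2 * scalar_curv G x * (G x $ j $ k * partial i F x - G x $ i $ k * partial j F x) = 0"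
    by (rule clear) (rule D_zero[OF assms, unfolded D_tensor_def])
  then show ?thesis
    by (simp add: algebra_simps)
qed

text \<open>The metric trace of the vanishing D-tensor; no Bianchi identity is needed.\<close>

lemma partial_scalar_curv:
  assumes "x \<in> U"
  shows "partial i (scalar_curv G) x = 2 * con x (\<lambda>k. ricci G i k x)"
proof -
  have "0 = tr x (\<lambda>j k. (2 * (real CARD('n) - 1) * partial i F x) * ricci G j k x - 2 * (real CARD('n) - 1) * (partial j F x * ricci G i k x)
    + partial i (scalar_curv G) x * G x $ j $ k - partial j (scalar_curv G) x * G x $ i $ k
    - (2 * scalar_curv G x * partial i F x) * G x $ j $ k
    + 2 * scalar_curv G x * (partial j F x * G x $ i $ k))"
    unfolding D_zero_cleared[OF assms] by (simp add: tr_def)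
  \<comment> \<open>The terms containing the scalar curvature undifferentiated cancel in the
    trace.\<close>
  also have "\<dots> = (real CARD('n) - 1) * (partial i (scalar_curv G) x - 2 * con x (\<lambda>k. ricci G i k x))"
    unfolding tr_linear tr_ricci tr_G[OF assms] tr_G_row[OF assms] tr_partial_left[OF assms]
    by (simp add: algebra_simps)
  finally show ?thesis using dim by simp
qed

text \<open>The skew part of \<open>D\<close> contracted with the gradient shows that
  \<open>rho\<close> is parallel to \<open>dF\<close>; substituting this back solves for the whole
  Ricci tensor.\<close>

lemma ricci_gradient:
  assumes x: "x \<in> U" and g: "gradient G F x \<noteq> 0"
  shows "con x (\<lambda>k. ricci G i k x) = eigval x * partial i F x"
    and "(real CARD('n) - 1) * con x (\<lambda>k. partial k F x) * ricci G j k x =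
      con x (\<lambda>k. partial k F x) * (scalar_curv G x - eigval x) * G x $ j $ k
      + (real CARD('n) * eigval x - scalar_curv G x) * (partial j F x * partial k F x)"
proof -
  define q where "q = con x (\<lambda>k. partial k F x)"
  define rho where "rho i = con x (\<lambda>k. ricci G i k x)" for i
  define R where "R = scalar_curv G x"
  have q: "q > 0" unfolding q_def by (rule norm_gradient_pos[OF x g])
  have G': "con x (\<lambda>i. G x $ i $ k) = partial k F x" for k
    using con_G[OF x, of k] by (simp add: G_sym[OF x, of k])
  have rho': "con x (\<lambda>i. ricci G i k x) = rho k" for k
    by (simp add: rho_def ricci_sym[OF x, of k])
  \<comment> \<open>\<open>D = 0\<close> contracted with the gradient in its first slot, with
    \<open>dR\<close> replaced by \<open>2 * rho\<close>.\<close>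
  have E: "2 * (real CARD('n) - 1) * (q * ricci G j k x - rho k * partial j F x) + 2 * con x rho * G x $ j $ k
      - 2 * rho j * partial k F x - 2 * R * (q * G x $ j $ k - partial j F x * partial k F x) = 0" for j k
  proof -
    have "0 = con x (\<lambda>i. (2 * (real CARD('n) - 1) * ricci G j k x) * partial i F x - (2 * (real CARD('n) - 1) * partial j F x) * ricci G i k x
      + (2 * G x $ j $ k) * rho i - (2 * rho j) * G x $ i $ k
      - (2 * R * G x $ j $ k) * partial i F x
      + (2 * R * partial j F x) * G x $ i $ k)"
      using D_zero_cleared[OF x, of _ j k, unfolded partial_scalar_curv[OF x], folded rho_def R_def]
      by (simp add: con_def algebra_simps)
    also have "\<dots> = 2 * (real CARD('n) - 1) * (q * ricci G j k x - rho k * partial j F x) + 2 * con x rho * G x $ j $ k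
      - 2 * rho j * partial k F x - 2 * R * (q * G x $ j $ k - partial j F x * partial k F x)"
      unfolding con_linear G' rho' q_def[symmetric] by (simp add: algebra_simps)
    finally show ?thesis by simp
  qed
  \<comment> \<open>The difference of \<open>E\<close> for \<open>j k\<close> and
    \<open>k j\<close>: the symmetric terms cancel, and the two mixed terms have weights
    \<open>n - 1\<close> and 1, hence the factor \<open>n - 2\<close>.\<close>
  have "(real CARD('n) - 2) * (rho k * partial j F x - rho j * partial k F x) = 0" for j k
    using E[of j k] E[of k j] by (simp add: ricci_sym[OF x, of k j] G_sym[OF x, of k j] algebra_simps)
  then have wedge: "partial j F x * rho k = rho j * partial k F x" for j k
    using dim by (simp add: mult.commute)
  have rho: "rho i = eigval x * partial i F x" for i
  proof -
    have "con x (\<lambda>k. partial i F x * rho k) = con x (\<lambda>k. rho i * partial k F x)"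
      unfolding wedge ..
    then have "partial i F x * con x rho = rho i * q"
      unfolding con_linear q_def .
    moreover have "con x rho = eigval x * q"
      using q by (simp add: eigval_def q_def rho_def[abs_def])
    ultimately have "q * (rho i - eigval x * partial i F x) = 0"
      by (auto simp: algebra_simps)
    then show ?thesis using q by simp
  qed
  then show "con x (\<lambda>k. ricci G i k x) = eigval x * partial i F x"
    by (simp add: rho_def)
  have "con x rho = eigval x * q"
    unfolding rho[abs_def] con_linear q_def ..
  with E[of j k] show "(real CARD('n) - 1) * con x (\<lambda>k. partial k F x) * ricci G j k x =
      con x (\<lambda>k. partial k F x) * (scalar_curv G x - eigval x) * G x $ j $ k
      + (real CARD('n) * eigval x - scalar_curv G x) * (partial j F x * partial k F x)"
    unfolding rho q_def[symmetric] R_def[symmetric] by (simp add: algebra_simps)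
qed

text \<open>Division of the cleared formula by \<open>(n - 1) * q\<close>, using that
  \<open>n * eigval - R\<close> equals \<open>(n - 1) * (eigval - mu)\<close>.\<close>

lemma ricci_decomposition:
  assumes x: "x \<in> U" and g: "gradient G F x \<noteq> 0"
  shows "ricci G j k x = mu x * G x $ j $ k + nu x * (partial j F x * partial k F x)"
proof -
  define q where "q = con x (\<lambda>k. partial k F x)"
  define p where "p = real CARD('n) - 1"
  have pos: "q > 0" "p > 0"
    using norm_gradient_pos[OF x g] dim by (auto simp: q_def p_def)
  have "p * q * ricci G j k x = q * (scalar_curv G x - eigval x) * G x $ j $ k
      + ((p + 1) * eigval x - scalar_curv G x) * (partial j F x * partial k F x)"
    using ricci_gradient(2)[OF x g, of j k] by (simp add: p_def q_def)
  also have "\<dots> = p * q * (mu x * G x $ j $ k + nu x * (partial j F x * partial k F x))"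
    using pos unfolding mu_def nu_def q_def[symmetric] p_def[symmetric] by (simp add: field_simps)
  finally show ?thesis
    using pos by simp
qed

section \<open>The covariant derivative of Ricci and its skew part\<close>

lemma cov_deriv_ricci:
  assumes x: "x \<in> U" and g: "gradient G F x \<noteq> 0"
  shows "cov_deriv2 G (ricci G) i j k x = partial i mu x * G x $ j $ k
    + partial i nu x * (partial j F x * partial k F x)
    + nu x * (partial j F x * hessian G F i k x + hessian G F i j x * partial k F x)"
proof -
  obtain l where l: "partial l F x \<noteq> 0"
    using g gradient_nonzero_iff[OF x] by blast
  \<comment> \<open>Differentiating the decomposition requires it near \<open>x\<close>; one nonzero
    coordinate derivative keeps the gradient nonzero on an open set.\<close>
  have "open (U \<inter> partial l F -` (- {0}))"
    by (intro continuous_open_preimage smooth_on_continuous smooth_on_partial smooth_F open_U) auto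
  moreover have "x \<in> U \<inter> partial l F -` (- {0})"
    using x l by simp
  moreover have "ricci G j k y = mu y * G y $ j $ k + nu y * (partial j F y * partial k F y)"
    if "y \<in> U \<inter> partial l F -` (- {0})" for y j k
    using that by (intro ricci_decomposition) (auto simp: gradient_nonzero_iff)
  ultimately have "partial i (ricci G j k) x =
      partial i (\<lambda>y. mu y * G y $ j $ k + nu y * (partial j F y * partial k F y)) x"
    by (rule partial_cong_open)
  also have "\<dots> = mu x * partial i (\<lambda>y. G y $ j $ k) x + partial i mu x * G x $ j $ k
      + (nu x * (partial j F x * partial i (partial k F) x + partial i (partial j F) x * partial k F x)
         + partial i nu x * (partial j F x * partial k F x))"
    by (simp add: partial_add partial_mult diff_mu_nu[OF x g] diff_G[OF x] diff_partial_F[OF x]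
        differentiable_mult)
  finally have d: "partial i (ricci G j k) x = \<dots>" .
  \<comment> \<open>The part with the metric cancels by metric compatibility; the part with
    \<open>dF\<close> completes second derivatives to Hessians.\<close>
  have "(\<Sum>m\<in>UNIV. \<Gamma> m i j x * ricci G m k x + \<Gamma> m i k x * ricci G j m x) =
      mu x * (\<Sum>m\<in>UNIV. \<Gamma> m i j x * G x $ m $ k + \<Gamma> m i k x * G x $ j $ m)
      + nu x * (partial k F x * (\<Sum>m\<in>UNIV. \<Gamma> m i j x * partial m F x)
                + partial j F x * (\<Sum>m\<in>UNIV. \<Gamma> m i k x * partial m F x))"
    unfolding ricci_decomposition[OF x g] sum_distrib_left sum.distrib[symmetric]
    by (rule sum.cong) (simp_all add: algebra_simps)
  moreover have "partial i (\<lambda>y. G y $ j $ k) x =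
      (\<Sum>m\<in>UNIV. \<Gamma> m i j x * G x $ m $ k + \<Gamma> m i k x * G x $ j $ m)"
    using cov_deriv_G[OF x, of i j k] by (simp add: cov_deriv2_def)
  ultimately show ?thesis
    unfolding cov_deriv2_def d hessian_def by (simp add: algebra_simps)
qed

text \<open>The Cotton tensor without its scalar curvature terms.\<close>

definition "S i j k x = cov_deriv2 G (ricci G) i j k x - cov_deriv2 G (ricci G) j i k x"

text \<open>The metric is parallel, so the soliton equation gives minus the derivative of the
  Hessian; this sign cancels the one in the Ricci identity.\<close>

lemma S_riemann:
  assumes x: "x \<in> U"
  shows "S i j k x = (\<Sum>l\<in>UNIV. riemann G i j k l x * partial l F x)"
proof -
  have "cov_deriv2 G (ricci G) i j k x = - cov_deriv2 G (hessian G F) i j k x" for i j k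
  proof -
    have "partial i (ricci G j k) x = partial i (\<lambda>y. (1/2) * G y $ j $ k - hessian G F j k y) x"
      by (rule partial_cong_open[OF open_U x ricci_hessian])
    also have "\<dots> = (1/2) * partial i (\<lambda>y. G y $ j $ k) x - partial i (hessian G F j k) x"
      using partial_mult[of "\<lambda>y. 1/2" x "\<lambda>y. G y $ j $ k" i]
      by (simp add: partial_diff partial_const diff_G[OF x] diff_hessian[OF smooth_F x] differentiable_mult)
    finally have "partial i (ricci G j k) x = \<dots>" .
    moreover have "(\<Sum>m\<in>UNIV. \<Gamma> m i j x * ricci G m k x + \<Gamma> m i k x * ricci G j m x) =
        (1/2) * (\<Sum>m\<in>UNIV. \<Gamma> m i j x * G x $ m $ k + \<Gamma> m i k x * G x $ j $ m)
        - (\<Sum>m\<in>UNIV. \<Gamma> m i j x * hessian G F m k x + \<Gamma> m i k x * hessian G F j m x)"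
      unfolding ricci_hessian[OF x] sum_distrib_left sum_subtractf[symmetric]
      by (rule sum.cong) (simp_all add: algebra_simps)
    moreover have "partial i (\<lambda>y. G y $ j $ k) x =
        (\<Sum>m\<in>UNIV. \<Gamma> m i j x * G x $ m $ k + \<Gamma> m i k x * G x $ j $ m)"
      using cov_deriv_G[OF x, of i j k] by (simp add: cov_deriv2_def)
    ultimately show ?thesis
      unfolding cov_deriv2_def by simp
  qed
  then show ?thesis
    using ricci_identity[OF smooth_F x, of i j k] by (simp add: S_def)
qed

text \<open>Writing \<open>dF\<close> as the lowered gradient exposes the fully covariant curvature,
  to which \<open>riemann_lower_antisym\<close> applies.\<close>

lemma S_lowered:
  assumes x: "x \<in> U"
  shows "S i j k x = con x (\<lambda>m. \<Sum>l\<in>UNIV. riemann G i j k l x * G x $ l $ m)"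
proof -
  have "S i j k x = (\<Sum>l\<in>UNIV. \<Sum>m\<in>UNIV. riemann G i j k l x * G x $ l $ m * gradient G F x $ m)"
    unfolding S_riemann[OF x] con_G[OF x, symmetric]
    by (simp add: con_def sum_distrib_left mult.assoc)
  also have "\<dots> = con x (\<lambda>m. \<Sum>l\<in>UNIV. riemann G i j k l x * G x $ l $ m)"
    unfolding con_def by (subst sum.swap) (simp add: sum_distrib_right)
  finally show ?thesis .
qed

text \<open>The gradient fills both slots of a skew pair of the curvature.\<close>

lemma con_S:
  assumes x: "x \<in> U"
  shows "con x (\<lambda>k. S i j k x) = 0"
proof -
  define L where "L k m = (\<Sum>l\<in>UNIV. riemann G i j k l x * G x $ l $ m)" for k m
  have L: "L k m = - L m k" for k m
    unfolding L_def by (rule riemann_lower_antisym[OF x])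
  have "con x (\<lambda>k. con x (\<lambda>m. L k m)) = (\<Sum>k\<in>UNIV. \<Sum>m\<in>UNIV. L k m * gradient G F x $ m * gradient G F x $ k)"
    by (simp add: con_def sum_distrib_right)
  also have "\<dots> = (\<Sum>k\<in>UNIV. \<Sum>m\<in>UNIV. L m k * gradient G F x $ m * gradient G F x $ k)"
    by (subst sum.swap) (simp add: mult_ac)
  also have "\<dots> = - (\<Sum>k\<in>UNIV. \<Sum>m\<in>UNIV. L k m * gradient G F x $ m * gradient G F x $ k)"
    unfolding sum_negf[symmetric] by (subst L) simp
  also have "(\<Sum>k\<in>UNIV. \<Sum>m\<in>UNIV. L k m * gradient G F x $ m * gradient G F x $ k) = con x (\<lambda>k. con x (\<lambda>m. L k m))"
    by (simp add: con_def sum_distrib_right)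
  finally show ?thesis
    unfolding S_lowered[OF x] L_def by simp
qed

text \<open>Skew symmetry in the last pair moves the gradient to the third slot of the curvature.
  The trace then pairs \<open>j\<close> with the output index, which is the Ricci contraction up to
  sign.\<close>

lemma tr_S:
  assumes x: "x \<in> U"
  shows "tr x (\<lambda>j k. S i j k x) = con x (\<lambda>m. ricci G i m x)"
proof -
  have rotate: "(\<Sum>j\<in>UNIV. \<Sum>k\<in>UNIV. \<Sum>m\<in>UNIV. H j k m) = (\<Sum>m\<in>UNIV. \<Sum>j\<in>UNIV. \<Sum>k\<in>UNIV. H j k m)"
    for H :: "'n \<Rightarrow> 'n \<Rightarrow> 'n \<Rightarrow> real"
    by (rule trans[OF sum.cong[OF refl sum.swap] sum.swap])
  define L where "L j m k = (\<Sum>l\<in>UNIV. riemann G i j m l x * G x $ l $ k)" for j m k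
  have trL: "tr x (\<lambda>j k. L j m k) = - ricci G i m x" for m
  proof -
    have "tr x (\<lambda>j k. L j m k) = (\<Sum>l\<in>UNIV. tr x (\<lambda>j k. riemann G i j m l x * G x $ l $ k))"
      unfolding tr_def L_def sum_distrib_left by (rule rotate)
    then show ?thesis
      unfolding tr_G_row[OF x] ricci_def by (simp add: riemann_swap[of i] sum_negf)
  qed
  have L: "L j k m = - L j m k" for j k m
    unfolding L_def by (rule riemann_lower_antisym[OF x])
  have "S i j k x = con x (\<lambda>m. - L j m k)" for j k
  proof -
    have "S i j k x = con x (\<lambda>m. L j k m)"
      by (simp only: S_lowered[OF x] L_def)
    also have "\<dots> = con x (\<lambda>m. - L j m k)"
      by (rule arg_cong[where f = "con x"], rule ext, rule L)
    finally show ?thesis .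
  qed
  then have "tr x (\<lambda>j k. S i j k x) =
      (\<Sum>j\<in>UNIV. \<Sum>k\<in>UNIV. \<Sum>m\<in>UNIV. - (ginv j k x * L j m k * gradient G F x $ m))"
    by (simp add: tr_def con_def sum_distrib_left mult.assoc)
  also have "\<dots> = con x (\<lambda>m. - tr x (\<lambda>j k. L j m k))"
    by (subst rotate) (simp add: con_def tr_def sum_distrib_right sum_negf)
  also have "\<dots> = con x (\<lambda>m. ricci G i m x)"
    by (simp add: trL)
  finally show ?thesis .
qed

text \<open>The Hessian also has the form metric plus multiple of \<open>dF\<close> squared, so the
  terms cubic in \<open>dF\<close> cancel in the skew part. The bracketing suits the trace
  rules.\<close>

lemma S_decomposition:
  assumes x: "x \<in> U" and g: "gradient G F x \<noteq> 0"
  shows "S i j k x = partial i mu x * G x $ j $ k - partial j mu x * G x $ i $ k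
    + (partial i nu x * (partial j F x * partial k F x) - partial i F x * (partial j nu x * partial k F x))
    - (nu x * (1/2 - mu x) * partial i F x) * G x $ j $ k
    + (nu x * (1/2 - mu x)) * (partial j F x * G x $ i $ k)"
proof -
  have h: "hessian G F i j x = (1/2 - mu x) * G x $ i $ j - nu x * (partial i F x * partial j F x)" for i j
    using soliton[OF x, of i j] ricci_decomposition[OF x g, of i j] by (simp add: algebra_simps)
  show ?thesis
    unfolding S_def cov_deriv_ricci[OF x g] h by (simp add: G_sym[OF x, of j i] algebra_simps)
qed

section \<open>Vanishing of the Cotton tensor\<close>

lemma cotton_zero:
  assumes x: "x \<in> U" and g: "gradient G F x \<noteq> 0"
  shows "cotton G i j k x = 0"
proof -
  define q where "q = con x (\<lambda>k. partial k F x)"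
  define c where "c = nu x * (1/2 - mu x)"
  have q: "q > 0" unfolding q_def by (rule norm_gradient_pos[OF x g])
  have A: "partial i mu x * partial j F x - partial j mu x * partial i F x
      + q * (partial i nu x * partial j F x - partial i F x * partial j nu x) = 0" for i j
  proof -
    have "0 = con x (\<lambda>k. partial i mu x * G x $ j $ k - partial j mu x * G x $ i $ k
      + (partial i nu x * partial j F x - partial i F x * partial j nu x) * partial k F x
      - (c * partial i F x) * G x $ j $ k + (c * partial j F x) * G x $ i $ k)"
      using con_S[OF x, of i j] unfolding S_decomposition[OF x g] c_def
      by (simp add: algebra_simps)
    then show ?thesis
      unfolding con_linear con_G[OF x] q_def by (simp add: algebra_simps)
  qed
  have B: "(real CARD('n) - 1) * partial i mu x + q * partial i nu x - partial i F x * con x (\<lambda>j. partial j nu x)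
      - (real CARD('n) - 1) * c * partial i F x = eigval x * partial i F x" for i
    using tr_S[OF x, of i]
    unfolding S_decomposition[OF x g] ricci_gradient(1)[OF x g] tr_linear tr_G[OF x] tr_G_row[OF x]
      tr_partial_right c_def[symmetric] q_def[symmetric]
    by (simp add: algebra_simps)
  \<comment> \<open>Wedging \<open>B\<close> with \<open>dF\<close> removes every term proportional
    to \<open>dF\<close>.\<close>
  have B': "(real CARD('n) - 1) * (partial i mu x * partial j F x - partial j mu x * partial i F x)
      + q * (partial i nu x * partial j F x - partial i F x * partial j nu x) = 0" for i j
    using arg_cong[OF B[of i], of "\<lambda>t. t * partial j F x"]
      arg_cong[OF B[of j], of "\<lambda>t. t * partial i F x"] by (simp add: algebra_simps)
  \<comment> \<open>\<open>B'\<close> minus \<open>A\<close> eliminates \<open>nu\<close>.\<close>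
  have "(real CARD('n) - 2) * (partial i mu x * partial j F x - partial j mu x * partial i F x) = 0" for i j
    using A[of i j] B'[of i j] by (simp add: algebra_simps)
  then have mu: "partial i mu x * partial j F x = partial i F x * partial j mu x" for i j
    using dim by (simp add: mult.commute)
  then have nu: "partial i nu x * partial j F x = partial i F x * partial j nu x" for i j
    using A[of i j] q by (simp add: mult.commute)
  \<comment> \<open>The factor of proportionality between \<open>dmu\<close> and \<open>dF\<close>,
    read off by contracting with the gradient.\<close>
  define a where "a = con x (\<lambda>j. partial j mu x) / q"
  have mu': "partial i mu x = a * partial i F x" for i
  proof -
    have "con x (\<lambda>j. partial i mu x * partial j F x) = con x (\<lambda>j. partial i F x * partial j mu x)"
      unfolding mu ..
    then have "partial i mu x * q = partial i F x * con x (\<lambda>j. partial j mu x)"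
      unfolding con_linear q_def .
    then show ?thesis using q by (simp add: a_def field_simps)
  qed
  have S: "S i j k x = (a - c) * (partial i F x * G x $ j $ k - partial j F x * G x $ i $ k)" for i j k
    using arg_cong[OF nu[of i j], of "\<lambda>t. t * partial k F x"]
    unfolding S_decomposition[OF x g] c_def[symmetric] mu' by (simp add: algebra_simps)
  obtain l where l: "partial l F x \<noteq> 0"
    using g gradient_nonzero_iff[OF x] by blast
  \<comment> \<open>Evaluating the trace of \<open>S\<close> in two ways determines
    \<open>a - c\<close>.\<close>
  have "eigval x * partial l F x = tr x (\<lambda>j k. S l j k x)"
    by (simp add: tr_S[OF x] ricci_gradient(1)[OF x g])
  also have "\<dots> = (a - c) * (real CARD('n) - 1) * partial l F x"
    unfolding S tr_linear tr_G[OF x] tr_G_row[OF x] by (simp add: algebra_simps)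
  finally have e: "eigval x = (a - c) * (real CARD('n) - 1)"
    using l by simp
  have "real CARD('n) - 1 \<noteq> 0" using dim by simp
  then have "1 / (2 * (real CARD('n) - 1)) * (2 * ((a - c) * (real CARD('n) - 1) * t)) = (a - c) * t" for t
    by (simp add: field_simps)
  note this[of "partial i F x * G x $ j $ k - partial j F x * G x $ i $ k"]
  \<comment> \<open>The derivative of the scalar curvature is \<open>2 * eigval\<close> times
    \<open>dF\<close>, so its terms reproduce exactly \<open>S\<close>.\<close>
  moreover have "cotton G i j k x = S i j k x - 1 / (2 * (real CARD('n) - 1)) * (2 * ((a - c) * (real CARD('n) - 1) *
      (partial i F x * G x $ j $ k - partial j F x * G x $ i $ k)))"
    unfolding cotton_def S_def[symmetric] partial_scalar_curv[OF x] ricci_gradient(1)[OF x g] e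
    by (simp add: algebra_simps)
  ultimately show ?thesis
    by (simp add: S)
qed

end

section \<open>From one chart to the manifold\<close>

theorem lemma4p2:
  fixes X :: "'a topology"
    and A :: "('a, 'n::finite) chart set"
    and g :: "('a, 'n) chart \<Rightarrow> 'n metric_comp"
    and f :: "'a \<Rightarrow> real"
  assumes dim: "CARD('n) \<ge> 4"
    and soliton: "complete_gradient_shrinking_soliton X A g f"
    and D_vanishes: "\<And>c x i j k. c \<in> A \<Longrightarrow> x \<in> chart_image c \<Longrightarrow>
          D_tensor (g c) (local_rep c f) i j k x = 0"
  shows "\<forall>p\<in>topspace X. \<forall>c\<in>A. p \<in> chart_dom c \<longrightarrow>
           gradient (g c) (local_rep c f) (chart_map c p) \<noteq> 0 \<longrightarrow>
           (\<forall>i j k. cotton (g c) i j k (chart_map c p) = 0)"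
proof (intro ballI impI allI)
  fix p c i j k
  assume c: "c \<in> A" and p: "p \<in> chart_dom c"
    and grad: "gradient (g c) (local_rep c f) (chart_map c p) \<noteq> 0"
  \<comment> \<open>Each chart of the atlas is an instance of the local setting on the open set
    \<open>chart_image c\<close>.\<close>
  have "D_flat_shrinker_chart (chart_image c) (g c) (local_rep c f)"
    using soliton c dim D_vanishes
    by unfold_locales
      (auto simp: complete_gradient_shrinking_soliton_def complete_riemannian_manifold_def
        smooth_manifold_def is_chart_def riemannian_metric_def smooth_function_def)
  then show "cotton (g c) i j k (chart_map c p) = 0"
    using p grad by (intro D_flat_shrinker_chart.cotton_zero) (auto simp: chart_image_def)
qed

end
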